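(* Let $\alpha=\lambda+\mathbf{i}\mu\in\mathbb{C}\setminus\mathbb{R}$ with $\lambda,\mu\in\mathbb{R}$, and let $(\mathfrak{g},\langle\cdot,\cdot\rangle)$ be a Ricci-parallel metric Lie algebra with Ricci operator $\mathrm{Ric}$. Then the minimal polynomial of $\mathrm{Ric}$ is $(X-\alpha)(X-\bar\alpha)$ if and only if there exists a unique pair $(\langle\cdot,\cdot\rangle',\mathbf{J})$ on $\mathfrak{g}$ such that $$\langle\cdot,\cdot\rangle=\frac{1}{\lambda^{2}+\mu^{2}}\left[\lambda\langle\cdot,\cdot\rangle'-\mu\langle\cdot,\mathbf{J}(\cdot)\rangle'\right],$$ where $\langle\cdot,\cdot\rangle'$ is an Einstein metric on the Lie algebra $\mathfrak{g}$ with Einstein constant $1$ and $\mathbf{J}:\mathfrak{g}\to\mathfrak{g}$ is an invariant complex structure on $\mathfrak{g}$ that is symmetric and parallel with respect to $\langle\cdot,\cdot\rangle'$.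
   Context: A metric Lie algebra $(\mathfrak{g},\langle\cdot,\cdot\rangle)$ is a finite-dimensional real Lie algebra $\mathfrak{g}$ with a metric, i.e. a nondegenerate symmetric bilinear form of arbitrary signature; it represents a connected Lie group with Lie algebra $\mathfrak{g}$ and the corresponding left invariant pseudo-Riemannian metric. Its Levi-Civita connection is the bilinear map $\nabla$ given by $2\langle\nabla_xy,z\rangle=\langle[x,y],z\rangle+\langle[z,x],y\rangle+\langle x,[z,y]\rangle$. Its curvature is $R(x,y)z=\nabla_x\nabla_yz-\nabla_y\nabla_xz-\nabla_{[x,y]}z$, its Ricci tensor is $\mathrm{ric}(x,y)=\mathrm{tr}(\xi\mapsto R(\xi,x)y)$, and its Ricci operator $\mathrm{Ric}$ is defined by $\langle\mathrm{Ric}(x),y\rangle=\mathrm{ric}(x,y)$. It is Einstein with Einstein constant $c\in\mathbb{R}$ if $\mathrm{ric}=c\langle\cdot,\cdot\rangle$, and Ricci-parallel if $\nabla\mathrm{ric}=0$, i.e. $\mathrm{ric}(\nabla_xy,z)+\mathrm{ric}(y,\nabla_xz)=0$ for all $x,y,z\in\mathfrak{g}$. An invariant complex structure on $\mathfrak{g}$ is a linear map $\mathbf{J}:\mathfrak{g}\to\mathfrak{g}$ with $\mathbf{J}^2=-\mathrm{Id}$ which is integrable (its Nijenhuis tensor vanishes), i.e. it induces a left invariant complex structure on the Lie group. It is symmetric with respect to $\langle\cdot,\cdot\rangle'$ if $\langle\mathbf{J}x,y\rangle'=\langle x,\mathbf{J}y\rangle'$ for all $x,y$, and parallel with respect to $\langle\cdot,\cdot\rangle'$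 if $\mathbf{J}\circ\nabla'_x=\nabla'_x\circ\mathbf{J}$ for all $x$, where $\nabla'$ is the Levi-Civita connection of $(\mathfrak{g},\langle\cdot,\cdot\rangle')$. *)

theory Defs
  imports "HOL-Analysis.Analysis" "HOL-Computational_Algebra.Polynomial"
begin

(* A finite-dimensional real vector space is modelled by a type of class euclidean_space.
   The inner product of the class is only an auxiliary means to name coordinates; apart from
   linear_trace, whose value does not depend on it, no definition below refers to it. *)

definition lie_algebra :: "('a::euclidean_space \<Rightarrow> 'a \<Rightarrow> 'a) \<Rightarrow> bool" where
  "lie_algebra br \<longleftrightarrow> bilinear br \<and> (\<forall>x. br x x = 0) \<and>
     (\<forall>x y z. br x (br y z) + br y (br z x) + br z (br x y) = 0)"

definition metric_form :: "('a::euclidean_space \<Rightarrow> 'a \<Rightarrow> real) \<Rightarrow> bool" where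
  "metric_form g \<longleftrightarrow> bilinear g \<and> (\<forall>x y. g x y = g y x) \<and> (\<forall>x. (\<forall>y. g x y = 0) \<longrightarrow> x = 0)"

definition linear_trace :: "('a::euclidean_space \<Rightarrow> 'a) \<Rightarrow> real" where
  "linear_trace f = (\<Sum>b\<in>Basis. f b \<bullet> b)"

(* The descriptions in levi_civita and ricci_operator denote unique vectors when br is a Lie
   bracket and g is a metric form, by nondegeneracy of g in finite dimension. *)

definition levi_civita ::
    "('a::euclidean_space \<Rightarrow> 'a \<Rightarrow> 'a) \<Rightarrow> ('a \<Rightarrow> 'a \<Rightarrow> real) \<Rightarrow> 'a \<Rightarrow> 'a \<Rightarrow> 'a" where
  "levi_civita br g x y =
     (THE v. \<forall>z. 2 * g v z = g (br x y) z + g (br z x) y + g x (br z y))"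

definition curvature ::
    "('a::euclidean_space \<Rightarrow> 'a \<Rightarrow> 'a) \<Rightarrow> ('a \<Rightarrow> 'a \<Rightarrow> real) \<Rightarrow> 'a \<Rightarrow> 'a \<Rightarrow> 'a \<Rightarrow> 'a" where
  "curvature br g x y z =
     levi_civita br g x (levi_civita br g y z) - levi_civita br g y (levi_civita br g x z)
       - levi_civita br g (br x y) z"

definition ricci ::
    "('a::euclidean_space \<Rightarrow> 'a \<Rightarrow> 'a) \<Rightarrow> ('a \<Rightarrow> 'a \<Rightarrow> real) \<Rightarrow> 'a \<Rightarrow> 'a \<Rightarrow> real" where
  "ricci br g x y = linear_trace (\<lambda>\<xi>. curvature br g \<xi> x y)"

definition ricci_operator ::
    "('a::euclidean_space \<Rightarrow> 'a \<Rightarrow> 'a) \<Rightarrow> ('a \<Rightarrow> 'a \<Rightarrow> real) \<Rightarrow> 'a \<Rightarrow> 'a" where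
  "ricci_operator br g x = (THE v. \<forall>y. g v y = ricci br g x y)"

definition einstein ::
    "('a::euclidean_space \<Rightarrow> 'a \<Rightarrow> 'a) \<Rightarrow> ('a \<Rightarrow> 'a \<Rightarrow> real) \<Rightarrow> real \<Rightarrow> bool" where
  "einstein br g c \<longleftrightarrow> (\<forall>x y. ricci br g x y = c * g x y)"

definition ricci_parallel ::
    "('a::euclidean_space \<Rightarrow> 'a \<Rightarrow> 'a) \<Rightarrow> ('a \<Rightarrow> 'a \<Rightarrow> real) \<Rightarrow> bool" where
  "ricci_parallel br g \<longleftrightarrow>
     (\<forall>x y z. ricci br g (levi_civita br g x y) z + ricci br g y (levi_civita br g x z) = 0)"

definition nijenhuis ::
    "('a::euclidean_space \<Rightarrow> 'a \<Rightarrow> 'a) \<Rightarrow> ('a \<Rightarrow> 'a) \<Rightarrow> 'a \<Rightarrow> 'a \<Rightarrow> 'a" where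
  "nijenhuis br J x y = br (J x) (J y) - J (br (J x) y) - J (br x (J y)) - br x y"

definition invariant_complex_structure ::
    "('a::euclidean_space \<Rightarrow> 'a \<Rightarrow> 'a) \<Rightarrow> ('a \<Rightarrow> 'a) \<Rightarrow> bool" where
  "invariant_complex_structure br J \<longleftrightarrow>
     linear J \<and> (\<forall>x. J (J x) = - x) \<and> (\<forall>x y. nijenhuis br J x y = 0)"

definition symmetric_wrt ::
    "('a::euclidean_space \<Rightarrow> 'a \<Rightarrow> real) \<Rightarrow> ('a \<Rightarrow> 'a) \<Rightarrow> bool" where
  "symmetric_wrt g J \<longleftrightarrow> (\<forall>x y. g (J x) y = g x (J y))"

definition parallel_wrt ::
    "('a::euclidean_space \<Rightarrow> 'a \<Rightarrow> 'a) \<Rightarrow> ('a \<Rightarrow> 'a \<Rightarrow> real) \<Rightarrow> ('a \<Rightarrow> 'a) \<Rightarrow> bool" where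
  "parallel_wrt br g J \<longleftrightarrow> (\<forall>x. J \<circ> levi_civita br g x = levi_civita br g x \<circ> J)"

definition poly_apply :: "real poly \<Rightarrow> ('a::real_vector \<Rightarrow> 'a) \<Rightarrow> 'a \<Rightarrow> 'a" where
  "poly_apply p f x = (\<Sum>i\<le>degree p. coeff p i *\<^sub>R (f ^^ i) x)"

definition is_minimal_polynomial :: "('a::real_vector \<Rightarrow> 'a) \<Rightarrow> real poly \<Rightarrow> bool" where
  "is_minimal_polynomial f p \<longleftrightarrow> lead_coeff p = 1 \<and> (\<forall>x. poly_apply p f x = 0) \<and>
     (\<forall>q. q \<noteq> 0 \<and> (\<forall>x. poly_apply q f x = 0) \<longrightarrow> degree p \<le> degree q)"

end

theory Submission
  imports Defs
begin

text \<open>A metric whose Levi-Civita connection is \<open>\<nabla>\<close> is the same as a metric preserved by the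
  torsion-free connection \<open>\<nabla>\<close>. Hence \<open>g\<close> and \<open>g'\<close> on either side of the equivalence have the
  same connection, the same curvature and the same Ricci tensor, and the Einstein condition forces
  \<open>g' = ric\<close>. The relation between the metrics then says exactly that \<open>Ric = \<lambda> + \<mu> J\<close>, so
  \<open>J\<^sup>2 = -1\<close> translates into the minimal polynomial of \<open>Ric\<close>. Parallelism of \<open>J\<close> is parallelism of
  \<open>Ric\<close>, and a parallel \<open>J\<close> is integrable because \<open>\<nabla>\<close> has no torsion.\<close>

section \<open>Nondegenerate symmetric bilinear forms\<close>

lemma metric_formD:
  assumes "metric_form g"
  shows "bilinear g" "g x y = g y x"
  using assms unfolding metric_form_def by blast+

lemma metric_form_eqI:
  assumes g: "metric_form g" and eq: "\<And>z. g v z = g w z"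
  shows "v = w"
proof -
  have "\<forall>y. g (v - w) y = 0"
    using eq by (simp add: bilinear_lsub[OF metric_formD(1)[OF g]])
  then have "v - w = 0"
    using g unfolding metric_form_def by blast
  then show ?thesis by simp
qed

lemma bilinear_form_operator:
  fixes g :: "'a::euclidean_space \<Rightarrow> 'a \<Rightarrow> real"
  assumes "bilinear g"
  obtains G where "linear G" "\<And>x y. g x y = G x \<bullet> y"
proof
  define G where "G x = (\<Sum>b\<in>Basis. g x b *\<^sub>R b)" for x
  have lin: "linear (g x)" for x
    using assms unfolding bilinear_def by auto
  show "linear G"
    unfolding G_def
    by (rule linearI)
      (simp_all add: bilinear_ladd[OF assms] bilinear_lmul[OF assms] scaleR_add_left sum.distrib
        scaleR_sum_right)
  show "g x y = G x \<bullet> y" for x y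
  proof -
    have "g x y = g x (\<Sum>b\<in>Basis. (y \<bullet> b) *\<^sub>R b)"
      by (simp add: euclidean_representation)
    also have "\<dots> = (\<Sum>b\<in>Basis. (y \<bullet> b) * g x b)"
      by (simp add: linear_sum[OF lin] linear_cmul[OF lin])
    also have "\<dots> = G x \<bullet> y"
      by (simp add: G_def inner_sum_left inner_commute[of y] mult.commute)
    finally show ?thesis .
  qed
qed

text \<open>Nondegeneracy makes the Gram operator \<open>G\<close> injective, hence invertible in
  finite dimension.\<close>

lemma metric_form_operator:
  fixes g :: "'a::euclidean_space \<Rightarrow> 'a \<Rightarrow> real"
  assumes g: "metric_form g"
  obtains G H where "linear G" "linear H" "\<And>x y. g x y = G x \<bullet> y"
    "\<And>x. G (H x) = x" "\<And>x. H (G x) = x"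
proof -
  obtain G where G: "linear G" "\<And>x y. g x y = G x \<bullet> y"
    using bilinear_form_operator metric_formD(1)[OF g] by blast
  have "inj G"
    by (rule injI) (rule metric_form_eqI[OF g], simp add: G(2))
  then obtain H where "linear H" "\<forall>x. H (G x) = x" "\<forall>x. G (H x) = x"
    using linear_injective_isomorphism[OF G(1)] by blast
  then show ?thesis using that G by blast
qed

text \<open>Riesz representation with arbitrary signature: \<open>adjoint \<phi> 1\<close>
  represents \<open>\<phi>\<close> for the inner product, and \<open>H\<close> carries it over to
  \<open>g\<close>. This is what makes the descriptions in \<open>levi_civita\<close> and
  \<open>ricci_operator\<close> denote.\<close>

lemma metric_form_representation:
  fixes g :: "'a::euclidean_space \<Rightarrow> 'a \<Rightarrow> real"
  assumes g: "metric_form g" and \<phi>: "linear \<phi>"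
  shows "\<exists>!v. \<forall>z. g v z = \<phi> z"
proof -
  obtain G H where GH: "\<And>x y. g x y = G x \<bullet> y" "\<And>x. G (H x) = x"
    using metric_form_operator[OF g] by metis
  have "g (H (adjoint \<phi> 1)) z = \<phi> z" for z
    using adjoint_works[OF \<phi>, of z 1] by (simp add: GH inner_commute)
  then show ?thesis
    using metric_form_eqI[OF g] by metis
qed

section \<open>Traces\<close>

lemma linear_trace_commute:
  fixes f h :: "'a::euclidean_space \<Rightarrow> 'a"
  assumes "linear f" and "linear h"
  shows "linear_trace (\<lambda>x. f (h x)) = linear_trace (\<lambda>x. h (f x))"
proof -
  have expand: "linear_trace (\<lambda>x. p (q x)) = (\<Sum>b\<in>Basis. \<Sum>c\<in>Basis. (q b \<bullet> c) * (p c \<bullet> b))"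
    if "linear p" for p q :: "'a \<Rightarrow> 'a"
    unfolding linear_trace_def
  proof (rule sum.cong[OF refl])
    fix b :: 'a
    have "p (q b) = p (\<Sum>c\<in>Basis. (q b \<bullet> c) *\<^sub>R c)"
      by (simp add: euclidean_representation)
    also have "\<dots> = (\<Sum>c\<in>Basis. (q b \<bullet> c) *\<^sub>R p c)"
      by (simp add: linear_sum[OF that] linear_cmul[OF that])
    finally show "p (q b) \<bullet> b = (\<Sum>c\<in>Basis. (q b \<bullet> c) * (p c \<bullet> b))"
      by (simp add: inner_sum_left)
  qed
  show ?thesis
    unfolding expand[OF assms(1)] expand[OF assms(2)]
    by (subst sum.swap) (simp add: mult.commute)
qed

lemma linear_trace_add: "linear_trace (\<lambda>x. f x + h x) = linear_trace f + linear_trace h"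
  by (simp add: linear_trace_def inner_add_left sum.distrib)

lemma linear_trace_diff: "linear_trace (\<lambda>x. f x - h x) = linear_trace f - linear_trace h"
  by (simp add: linear_trace_def inner_diff_left sum_subtractf)

lemma linear_trace_scaleR: "linear_trace (\<lambda>x. c *\<^sub>R f x) = c * linear_trace f"
  by (simp add: linear_trace_def sum_distrib_left)

text \<open>Skewness says that \<open>G A H\<close>, with \<open>H\<close> inverse to
  \<open>G\<close>, is minus the transpose of \<open>A\<close>; conjugation and transposition
  preserve the trace, so it equals its own negative.\<close>

lemma linear_trace_skew:
  fixes A :: "'a::euclidean_space \<Rightarrow> 'a"
  assumes g: "metric_form g" and A: "linear A" and skew: "\<And>x y. g (A x) y + g x (A y) = 0"
  shows "linear_trace A = 0"
proof -
  obtain G H where GH: "linear G" "linear H" "\<And>x y. g x y = G x \<bullet> y"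
    "\<And>x. G (H x) = x" "\<And>x. H (G x) = x"
    using metric_form_operator[OF g] by metis
  have "G (A x) \<bullet> y = - (G x \<bullet> A y)" for x y
    using skew[of x y] by (simp add: GH)
  then have "linear_trace (\<lambda>x. G (A (H x))) = (\<Sum>b\<in>Basis. - (b \<bullet> A b))"
    by (simp add: linear_trace_def GH)
  also have "\<dots> = - linear_trace A"
    by (simp add: linear_trace_def sum_negf inner_commute)
  finally have "linear_trace (\<lambda>x. G (A (H x))) = - linear_trace A" .
  moreover have "linear_trace (\<lambda>x. G (A (H x))) = linear_trace A"
    using linear_trace_commute[of G "\<lambda>x. A (H x)"] linear_compose[OF GH(2) A]
    by (simp add: GH o_def)
  ultimately show ?thesis by simp
qed

section \<open>Lie algebras and the Levi-Civita connection\<close>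

lemma lie_algebraD:
  assumes "lie_algebra br"
  shows "bilinear br" "br x y = - br y x"
    "br x (br y z) + br y (br z x) + br z (br x y) = 0"
proof -
  show bil: "bilinear br"
    using assms unfolding lie_algebra_def by blast
  have z: "br u u = 0" for u
    using assms unfolding lie_algebra_def by blast
  have "br (x + y) (x + y) = br x x + br x y + (br y x + br y y)"
    by (simp only: bilinear_ladd[OF bil] bilinear_radd[OF bil] add_ac)
  then have "br x y + br y x = 0"
    by (simp add: z)
  then show "br x y = - br y x"
    by (simp add: eq_neg_iff_add_eq_0)
  show "br x (br y z) + br y (br z x) + br z (br x y) = 0"
    using assms unfolding lie_algebra_def by blast
qed

lemmas bilinear_simps =
  bilinear_ladd bilinear_radd bilinear_lmul bilinear_rmul bilinear_lneg bilinear_rneg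
  bilinear_lsub bilinear_rsub

text \<open>The right-hand side is linear in \<open>z\<close>, so half of it is represented by a
  unique vector.\<close>

lemma koszul:
  assumes L: "lie_algebra br" and g: "metric_form g"
  shows "2 * g (levi_civita br g x y) z = g (br x y) z + g (br z x) y + g x (br z y)"
proof -
  note b = bilinear_simps[OF metric_formD(1)[OF g]] bilinear_simps[OF lie_algebraD(1)[OF L]]
  define \<phi> where "\<phi> z = (g (br x y) z + g (br z x) y + g x (br z y)) / 2" for z
  have "linear \<phi>"
    by (rule linearI) (simp_all add: \<phi>_def b field_simps)
  from metric_form_representation[OF g this]
  have "\<exists>!v. \<forall>z. 2 * g v z = g (br x y) z + g (br z x) y + g x (br z y)"
    by (simp add: \<phi>_def field_simps)
  from theI'[OF this] show ?thesis
    unfolding levi_civita_def by blast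
qed

text \<open>In the sum of the Koszul formulas for \<open>(x, y, z)\<close> and
  \<open>(x, z, y)\<close> all terms on the right cancel in pairs.\<close>

lemma levi_civita_metric:
  assumes L: "lie_algebra br" and g: "metric_form g"
  shows "g (levi_civita br g x y) z + g y (levi_civita br g x z) = 0"
proof -
  note b = bilinear_simps[OF metric_formD(1)[OF g]]
  have s: "g (br v u) w = - g (br u v) w" "g u v = g v u" for u v w
    using lie_algebraD(2)[OF L, of v u] metric_formD(2)[OF g] by (simp_all add: b)
  show ?thesis
    using koszul[OF L g, of x y z] koszul[OF L g, of x z y]
      s(1)[of x y] s(1)[of x z] s(1)[of y z]
      s(2)[of y "levi_civita br g x z"] s(2)[of x "br z y"] s(2)[of x "br y z"]
    by (smt (verit))
qed

lemma levi_civita_torsion_free: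
  assumes L: "lie_algebra br" and g: "metric_form g"
  shows "levi_civita br g x y - levi_civita br g y x = br x y"
proof (rule metric_form_eqI[OF g])
  fix z
  note b = bilinear_simps[OF metric_formD(1)[OF g]]
  have "g (br y x) z = - g (br x y) z"
    using lie_algebraD(2)[OF L, of y x] by (simp add: b)
  then show "g (levi_civita br g x y - levi_civita br g y x) z = g (br x y) z"
    using koszul[OF L g, of x y z] koszul[OF L g, of y x z]
      metric_formD(2)[OF g, of x "br z y"] metric_formD(2)[OF g, of y "br z x"]
    by (simp add: b)
qed

text \<open>Writing each bracket in the Koszul formula as a difference of \<open>D\<close>-terms,
  metric compatibility leaves only \<open>2 * g (D x y) z\<close>. This is the tool for showing that
  two metrics share a connection.\<close>

lemma levi_civita_unique:
  assumes L: "lie_algebra br" and g: "metric_form g"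
    and metric: "\<And>x y z. g (D x y) z + g y (D x z) = 0"
    and torsion: "\<And>x y. D x y - D y x = br x y"
  shows "levi_civita br g = D"
proof (intro ext)
  fix x y
  note b = bilinear_simps[OF metric_formD(1)[OF g]]
  show "levi_civita br g x y = D x y"
  proof (rule metric_form_eqI[OF g])
    fix z
    show "g (levi_civita br g x y) z = g (D x y) z"
      using koszul[OF L g, of x y z] metric[of x y z] metric[of y x z] metric[of z x y]
        metric_formD(2)[OF g, of y "D x z"]
      unfolding torsion[symmetric] by (simp add: b)
  qed
qed

lemma levi_civita_bilinear:
  assumes L: "lie_algebra br" and g: "metric_form g"
  shows "bilinear (levi_civita br g)"
proof -
  note b = bilinear_simps[OF metric_formD(1)[OF g]] bilinear_simps[OF lie_algebraD(1)[OF L]]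
  let ?D = "levi_civita br g"
  have K: "g (?D x y) z = (g (br x y) z + g (br z x) y + g x (br z y)) / 2" for x y z
    using koszul[OF L g, of x y z] by simp
  show ?thesis
    unfolding bilinear_def
    by (intro conjI allI linearI metric_form_eqI[OF g]) (simp_all add: b K field_simps)
qed

section \<open>Curvature and the Ricci tensor\<close>

lemma curvature_linear:
  assumes L: "lie_algebra br" and g: "metric_form g"
  shows "linear (curvature br g x y)"
  unfolding curvature_def
  by (rule linearI)
    (simp_all add: bilinear_simps[OF levi_civita_bilinear[OF L g]] algebra_simps)

text \<open>Each \<open>levi_civita br g p\<close> is skew for \<open>g\<close>, and commutators and
  differences of skew operators are skew.\<close>

lemma curvature_skew:
  assumes L: "lie_algebra br" and g: "metric_form g"
  shows "g (curvature br g x y u) v + g u (curvature br g x y v) = 0"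
proof -
  note b = bilinear_simps[OF metric_formD(1)[OF g]]
  let ?D = "levi_civita br g"
  have m: "g (?D p q) r = - g q (?D p r)" for p q r
    using levi_civita_metric[OF L g, of p q r] by simp
  show ?thesis
    by (simp add: curvature_def b m)
qed

text \<open>Vanishing torsion, used twice, turns the cyclic sum into the Jacobi identity.\<close>

lemma bianchi:
  assumes L: "lie_algebra br" and g: "metric_form g"
  shows "curvature br g x y z + curvature br g y z x + curvature br g z x y = 0"
proof -
  let ?D = "levi_civita br g"
  note b = bilinear_simps[OF levi_civita_bilinear[OF L g]]
  have t: "?D p (?D q r) - ?D p (?D r q) = ?D p (br q r)" for p q r
    using levi_civita_torsion_free[OF L g, of q r] b(8) by metis
  have "curvature br g x y z + curvature br g y z x + curvature br g z x y
    = (?D x (br y z) - ?D (br y z) x) + (?D y (br z x) - ?D (br z x) y)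
      + (?D z (br x y) - ?D (br x y) z)"
    unfolding curvature_def t[symmetric] by (simp add: algebra_simps)
  also have "\<dots> = 0"
    unfolding levi_civita_torsion_free[OF L g] by (rule lie_algebraD(3)[OF L])
  finally show ?thesis .
qed

text \<open>Taking the trace of the Bianchi identity, the skew operator \<open>R(x,y)\<close> does not contribute.\<close>

lemma ricci_symmetric:
  assumes L: "lie_algebra br" and g: "metric_form g"
  shows "ricci br g x y = ricci br g y x"
proof -
  have anti: "curvature br g y u x = - curvature br g u y x" for u
    using lie_algebraD(2)[OF L, of y u] bilinear_lneg[OF levi_civita_bilinear[OF L g]]
    by (simp add: curvature_def)
  have "curvature br g u x y = curvature br g u y x - curvature br g x y u" for u
    using bianchi[OF L g, of u x y] anti[of u] by (simp add: algebra_simps add_eq_0_iff)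
  then have "ricci br g x y = ricci br g y x - linear_trace (curvature br g x y)"
    by (simp add: ricci_def linear_trace_diff)
  also have "linear_trace (curvature br g x y) = 0"
    by (intro linear_trace_skew[OF g] curvature_linear curvature_skew L g)
  finally show ?thesis by simp
qed

text \<open>Linearity in the second argument comes from the curvature; symmetry transfers it to the
  first.\<close>

lemma ricci_bilinear:
  assumes L: "lie_algebra br" and g: "metric_form g"
  shows "bilinear (ricci br g)"
  unfolding bilinear_def
proof (intro conjI allI)
  show *: "linear (ricci br g x)" for x
    unfolding ricci_def
    by (rule linearI) (simp_all add: linear_add[OF curvature_linear[OF L g]]
        linear_cmul[OF curvature_linear[OF L g]] linear_trace_add linear_trace_scaleR)
  show "linear (\<lambda>x. ricci br g x y)" for y
    using *[of y] by (subst ricci_symmetric[OF L g])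
qed

lemma ricci_operator:
  assumes L: "lie_algebra br" and g: "metric_form g"
  shows "g (ricci_operator br g x) y = ricci br g x y"
proof -
  have "linear (ricci br g x)"
    using ricci_bilinear[OF L g] unfolding bilinear_def by blast
  from theI'[OF metric_form_representation[OF g this]] show ?thesis
    unfolding ricci_operator_def by blast
qed

lemma ricci_operator_symmetric:
  assumes L: "lie_algebra br" and g: "metric_form g"
  shows "g (ricci_operator br g x) y = g x (ricci_operator br g y)"
  using ricci_operator[OF L g] ricci_symmetric[OF L g] metric_formD(2)[OF g] by metis

lemma ricci_operator_linear:
  assumes L: "lie_algebra br" and g: "metric_form g"
  shows "linear (ricci_operator br g)"
  by (intro linearI metric_form_eqI[OF g])
    (simp_all add: ricci_operator[OF L g] bilinear_simps[OF metric_formD(1)[OF g]]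
      bilinear_simps[OF ricci_bilinear[OF L g]])

text \<open>Once the Ricci tensor is written through \<open>g\<close>, the skewness of the
  connection moves the derivative from \<open>z\<close> onto \<open>?R y\<close>.\<close>

lemma ricci_operator_parallel:
  assumes L: "lie_algebra br" and g: "metric_form g" and par: "ricci_parallel br g"
  shows "ricci_operator br g (levi_civita br g x y) = levi_civita br g x (ricci_operator br g y)"
proof (rule metric_form_eqI[OF g])
  fix z
  let ?D = "levi_civita br g" and ?R = "ricci_operator br g"
  have "g (?R (?D x y)) z + g (?R y) (?D x z) = 0"
    using par unfolding ricci_parallel_def by (simp add: ricci_operator[OF L g])
  then show "g (?R (?D x y)) z = g (?D x (?R y)) z"
    using levi_civita_metric[OF L g, of x "?R y" z] by simp
qed

text \<open>The metric enters the curvature only through its connection, and the trace does not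
  involve the metric.\<close>

lemma ricci_cong:
  assumes "levi_civita br g = levi_civita br h"
  shows "ricci br g = ricci br h"
  by (simp add: ricci_def curvature_def assms fun_eq_iff)

text \<open>After each bracket is written as a difference of covariant derivatives, \<open>J\<close>
  moves inside them and all terms cancel by \<open>J (J x) = - x\<close>.\<close>

lemma nijenhuis_parallel:
  assumes L: "lie_algebra br" and g: "metric_form g" and J: "linear J" "\<And>x. J (J x) = - x"
    and par: "\<And>x y. J (levi_civita br g x y) = levi_civita br g x (J y)"
  shows "nijenhuis br J x y = 0"
proof -
  let ?D = "levi_civita br g"
  have "nijenhuis br J x y = (?D (J x) (J y) - ?D (J y) (J x)) - J (?D (J x) y - ?D y (J x))
      - J (?D x (J y) - ?D (J y) x) - (?D x y - ?D y x)"
    by (simp only: nijenhuis_def levi_civita_torsion_free[OF L g])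
  also have "\<dots> = 0"
    by (simp add: linear_diff[OF J(1)] par J(2) bilinear_rneg[OF levi_civita_bilinear[OF L g]])
  finally show ?thesis .
qed

section \<open>The minimal polynomial\<close>

text \<open>The product has the real coefficients given by the norm and minus the trace of
  \<open>\<alpha>\<close>, and the embedding of the reals is injective on coefficients.\<close>

lemma map_poly_quadratic:
  fixes l m :: real
  assumes "\<alpha> = of_real l + \<i> * of_real m"
  shows "map_poly complex_of_real p = [:- \<alpha>, 1:] * [:- cnj \<alpha>, 1:]
    \<longleftrightarrow> p = [:l\<^sup>2 + m\<^sup>2, - 2 * l, 1:]"
proof -
  have "[:- \<alpha>, 1:] * [:- cnj \<alpha>, 1:] = map_poly complex_of_real [:l\<^sup>2 + m\<^sup>2, - 2 * l, 1:]"
    by (simp add: assms map_poly_pCons complex_eq_iff power2_eq_square)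
  then show ?thesis
    by (auto simp: poly_eq_iff coeff_map_poly)
qed

lemma poly_apply_quadratic:
  "poly_apply [:a, b, 1:] f x = a *\<^sub>R x + b *\<^sub>R f x + f (f x)"
  by (simp add: poly_apply_def numeral_2_eq_2)

text \<open>Since \<open>m \<noteq> 0\<close> and the space is nonzero, \<open>l + m J\<close> is not a scalar.\<close>

lemma minimal_polynomial_complex:
  fixes f J :: "'a::euclidean_space \<Rightarrow> 'a"
  assumes J: "linear J" "\<And>x. J (J x) = - x" and "m \<noteq> 0"
    and f: "\<And>x. f x = l *\<^sub>R x + m *\<^sub>R J x"
  shows "is_minimal_polynomial f [:l\<^sup>2 + m\<^sup>2, - 2 * l, 1:]"
  unfolding is_minimal_polynomial_def
proof (intro conjI allI impI)
  show "lead_coeff [:l\<^sup>2 + m\<^sup>2, - 2 * l, 1:] = 1" by simp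
  show "poly_apply [:l\<^sup>2 + m\<^sup>2, - 2 * l, 1:] f x = 0" for x
    by (simp add: poly_apply_quadratic f linear_add[OF J(1)] linear_cmul[OF J(1)] J(2)
        algebra_simps power2_eq_square flip: scaleR_add_left)
  show "degree [:l\<^sup>2 + m\<^sup>2, - 2 * l, 1:] \<le> degree q"
    if q: "q \<noteq> 0 \<and> (\<forall>x. poly_apply q f x = 0)" for q
  proof (rule ccontr)
    assume "\<not> ?thesis"
    then have "degree q \<le> 1" by simp
    then obtain a b where ab: "q = [:a, b:]"
      by (metis degree1_coeffs degree_0_id le_neq_implies_less less_one pCons_0_0 degree_eq_zeroE)
    obtain e :: 'a where e: "e \<noteq> 0"
      using nonzero_Basis SOME_Basis by blast
    \<comment> \<open>Substituting \<open>f = l + m J\<close> gives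
      \<open>a + b f = s + t J\<close>.\<close>
    define s t where "s = a + b * l" and "t = b * m"
    have "poly_apply q f x = a *\<^sub>R x + b *\<^sub>R f x" for x
      by (cases "b = 0") (simp_all add: ab poly_apply_def)
    then have sx: "s *\<^sub>R x + t *\<^sub>R J x = 0" for x
      using q by (simp add: f s_def t_def algebra_simps)
    \<comment> \<open>Multiplying \<open>s + t J\<close> by its conjugate \<open>s - t J\<close>
      gives the scalar \<open>s\<^sup>2 + t\<^sup>2\<close>.\<close>
    have "(s\<^sup>2 + t\<^sup>2) *\<^sub>R e = s *\<^sub>R (s *\<^sub>R e + t *\<^sub>R J e) - t *\<^sub>R (s *\<^sub>R J e + t *\<^sub>R J (J e))"
      by (simp add: J(2) algebra_simps power2_eq_square)
    then have "s\<^sup>2 + t\<^sup>2 = 0"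
      using sx[of e] sx[of "J e"] e by simp
    then have "s = 0" "t = 0" by (simp_all add: sum_power2_eq_zero_iff)
    then show False
      using q ab \<open>m \<noteq> 0\<close> by (simp add: s_def t_def)
  qed
qed

section \<open>From a pair to the Ricci operator\<close>

text \<open>One fixed pair as on the right of the equivalence. The results express \<open>g'\<close>
  and \<open>J\<close> through \<open>br\<close> and \<open>g\<close>, which yields
  uniqueness.\<close>

locale einstein_complex_pair =
  fixes br :: "'a::euclidean_space \<Rightarrow> 'a \<Rightarrow> 'a" and g g' :: "'a \<Rightarrow> 'a \<Rightarrow> real"
    and J :: "'a \<Rightarrow> 'a" and l m :: real
  assumes L: "lie_algebra br" and g: "metric_form g" and m: "m \<noteq> 0"
    and g': "metric_form g'" and einstein: "einstein br g' 1"
    and complex: "invariant_complex_structure br J"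
    and symmetric: "symmetric_wrt g' J" and parallel: "parallel_wrt br g' J"
    and g_eq: "\<forall>x y. g x y = 1 / (l\<^sup>2 + m\<^sup>2) * (l * g' x y - m * g' x (J y))"
begin

lemma J: "linear J" "J (J x) = - x"
  using complex unfolding invariant_complex_structure_def by auto

text \<open>As \<open>J\<close> commutes with the connection of \<open>g'\<close>, that connection
  preserves both \<open>g'\<close> and \<open>g'(., J .)\<close>, hence also their combination
  \<open>g\<close>.\<close>

lemma levi_civita_eq: "levi_civita br g = levi_civita br g'"
proof (rule levi_civita_unique[OF L g])
  fix x y z
  let ?D = "levi_civita br g'"
  have "J (?D x z) = ?D x (J z)"
    using parallel unfolding parallel_wrt_def by (metis comp_apply)
  then have "g (?D x y) z + g y (?D x z) = 1 / (l\<^sup>2 + m\<^sup>2) *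
      (l * (g' (?D x y) z + g' y (?D x z)) - m * (g' (?D x y) (J z) + g' y (?D x (J z))))"
    by (simp add: g_eq algebra_simps)
  then show "g (?D x y) z + g y (?D x z) = 0"
    by (simp add: levi_civita_metric[OF L g'])
  show "?D x y - ?D y x = br x y"
    by (rule levi_civita_torsion_free[OF L g'])
qed

lemma metric_eq_ricci: "g' = ricci br g"
  using einstein ricci_cong[OF levi_civita_eq] by (simp add: einstein_def fun_eq_iff)

text \<open>The operator \<open>(l - m J) / (l\<^sup>2 + m\<^sup>2)\<close> is inverse to
  \<open>l + m J\<close>, so the relation between the metrics says that
  \<open>g ((l + m J) x) y = g' x y\<close>, and \<open>g'\<close> is the Ricci tensor.\<close>

lemma ricci_operator_eq: "ricci_operator br g x = l *\<^sub>R x + m *\<^sub>R J x"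
proof (rule metric_form_eqI[OF g])
  fix y
  have "l\<^sup>2 + m\<^sup>2 \<noteq> 0" using m by (simp add: sum_power2_eq_zero_iff)
  moreover have "g' (J x) (J y) = - g' x y" "g' (J x) y = g' x (J y)"
    using symmetric J(2) bilinear_simps[OF metric_formD(1)[OF g']]
    unfolding symmetric_wrt_def by metis+
  ultimately have "g (l *\<^sub>R x + m *\<^sub>R J x) y = g' x y"
    by (simp add: g_eq bilinear_simps[OF metric_formD(1)[OF g']] field_simps power2_eq_square)
  then show "g (ricci_operator br g x) y = g (l *\<^sub>R x + m *\<^sub>R J x) y"
    by (simp add: ricci_operator[OF L g] metric_eq_ricci)
qed

lemma complex_structure_eq: "J = (\<lambda>x. (1 / m) *\<^sub>R (ricci_operator br g x - l *\<^sub>R x))"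
  using m by (simp add: ricci_operator_eq)

end

section \<open>From the Ricci operator to a pair\<close>

text \<open>Completing the square, \<open>quadratic\<close> reads
  \<open>(Ric - l)\<^sup>2 = - m\<^sup>2\<close>; therefore \<open>(Ric - l) / m\<close> squares to
  \<open>-1\<close>.\<close>

lemma einstein_complex_pair_of_ricci:
  fixes br :: "'a::euclidean_space \<Rightarrow> 'a \<Rightarrow> 'a"
  assumes L: "lie_algebra br" and g: "metric_form g" and par: "ricci_parallel br g"
    and m: "m \<noteq> 0"
    and quadratic: "\<And>x. (l\<^sup>2 + m\<^sup>2) *\<^sub>R x + (- 2 * l) *\<^sub>R ricci_operator br g x
      + ricci_operator br g (ricci_operator br g x) = 0"
  shows "einstein_complex_pair br g (ricci br g)
    (\<lambda>x. (1 / m) *\<^sub>R (ricci_operator br g x - l *\<^sub>R x)) l m"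
proof -
  let ?D = "levi_civita br g" and ?R = "ricci_operator br g" and ?h = "ricci br g"
  define J where "J x = (1 / m) *\<^sub>R (?R x - l *\<^sub>R x)" for x
  note bg = bilinear_simps[OF metric_formD(1)[OF g]]
    and bD = bilinear_simps[OF levi_civita_bilinear[OF L g]]
    and R = ricci_operator_linear[OF L g]
  have pos: "l\<^sup>2 + m\<^sup>2 \<noteq> 0" using m by (simp add: sum_power2_eq_zero_iff)
  have RR: "?R (?R x) = (2 * l) *\<^sub>R ?R x - (l\<^sup>2 + m\<^sup>2) *\<^sub>R x" for x
    using quadratic[of x] by (simp add: algebra_simps add_eq_0_iff)
  have J: "linear J"
    by (rule linearI) (simp_all add: J_def linear_add[OF R] linear_cmul[OF R] algebra_simps)
  have JJ: "J (J x) = - x" for x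
  proof -
    have "J (J x) = (1 / m\<^sup>2) *\<^sub>R (?R (?R x) - (2 * l) *\<^sub>R ?R x + l\<^sup>2 *\<^sub>R x)"
      by (simp add: J_def linear_diff[OF R] linear_cmul[OF R] algebra_simps power2_eq_square
          flip: scaleR_add_left)
    also have "\<dots> = - x"
      using m by (simp add: RR algebra_simps)
    finally show ?thesis .
  qed
  have R_eq: "?R x = l *\<^sub>R x + m *\<^sub>R J x" for x
    using m by (simp add: J_def)
  have J_sym: "?h (J x) y = ?h x (J y)" for x y
  proof -
    \<comment> \<open>\<open>J\<close> is a polynomial in the self-adjoint operator
      \<open>?R\<close>.\<close>
    have "g (?R (J x)) y = g (?R x) (J y)"
      by (simp add: J_def linear_diff[OF R] linear_cmul[OF R] bg ricci_operator_symmetric[OF L g])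
    then show ?thesis by (simp add: ricci_operator[OF L g])
  qed
  have J_par: "J (?D x y) = ?D x (J y)" for x y
    by (simp add: J_def ricci_operator_parallel[OF L g par] bD)
  \<comment> \<open>Nondegeneracy of the Ricci tensor amounts to injectivity of \<open>?R\<close>,
    which holds because the constant term \<open>l\<^sup>2 + m\<^sup>2\<close> is nonzero.\<close>
  have h: "metric_form ?h"
    unfolding metric_form_def
  proof (intro conjI allI impI)
    show "bilinear ?h" by (rule ricci_bilinear[OF L g])
    show "?h x y = ?h y x" for x y by (rule ricci_symmetric[OF L g])
    show "x = 0" if "\<forall>y. ?h x y = 0" for x
    proof -
      have "?R x = 0"
        using g that unfolding metric_form_def ricci_operator[OF L g, symmetric] by blast
      then show ?thesis
        using RR[of x] linear_0[OF R] pos by auto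
    qed
  qed
  \<comment> \<open>Being Ricci-parallel means that the torsion-free \<open>?D\<close> is metric for
    \<open>?h\<close>. Equal connections give equal Ricci tensors, so \<open>?h\<close> is its own
    Ricci tensor: Einstein with constant 1.\<close>
  have D: "levi_civita br ?h = ?D"
    using par by (intro levi_civita_unique[OF L h] levi_civita_torsion_free[OF L g])
      (simp add: ricci_parallel_def)
  have "g x y = 1 / (l\<^sup>2 + m\<^sup>2) * (l * ?h x y - m * ?h x (J y))" for x y
  proof -
    have "l * ?h x y - m * ?h x (J y) = g x (l *\<^sub>R ?R y - m *\<^sub>R ?R (J y))"
      by (simp add: ricci_operator[OF L g, symmetric] ricci_operator_symmetric[OF L g] bg)
    \<comment> \<open>This is the product of \<open>l + m J\<close> with its conjugate
      \<open>l - m J\<close>.\<close>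
    also have "l *\<^sub>R ?R y - m *\<^sub>R ?R (J y) = (l\<^sup>2 + m\<^sup>2) *\<^sub>R y"
      by (simp add: R_eq JJ algebra_simps power2_eq_square)
    finally show ?thesis using pos by (simp add: bg)
  qed
  then have "einstein_complex_pair br g ?h J l m"
    using L g m h J JJ J_sym J_par nijenhuis_parallel[OF L g J JJ J_par]
    by unfold_locales
      (auto simp: einstein_def ricci_cong[OF D] invariant_complex_structure_def symmetric_wrt_def
        parallel_wrt_def D)
  then show ?thesis
    unfolding J_def .
qed

theorem theorem1p1:
  fixes br :: "'a::euclidean_space \<Rightarrow> 'a \<Rightarrow> 'a"
    and g :: "'a \<Rightarrow> 'a \<Rightarrow> real"
    and \<alpha> :: complex and l m :: real
  assumes "\<alpha> = of_real l + \<i> * of_real m" and "\<alpha> \<notin> \<real>"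
    and "lie_algebra br" and "metric_form g" and "ricci_parallel br g"
  shows "(\<exists>p. is_minimal_polynomial (ricci_operator br g) p \<and>
            map_poly complex_of_real p = [:- \<alpha>, 1:] * [:- cnj \<alpha>, 1:])
    \<longleftrightarrow>
    (\<exists>!(g', J).
        metric_form g' \<and> einstein br g' 1 \<and>
        invariant_complex_structure br J \<and> symmetric_wrt g' J \<and> parallel_wrt br g' J \<and>
        (\<forall>x y. g x y = 1 / (l\<^sup>2 + m\<^sup>2) * (l * g' x y - m * g' x (J y))))"
    (is "?minpoly \<longleftrightarrow> ?pair")
proof -
  have m: "m \<noteq> 0" using assms(1,2) by auto
  have pair_iff: "?pair \<longleftrightarrow> (\<exists>!(g', J). einstein_complex_pair br g g' J l m)"
    unfolding einstein_complex_pair_def using assms(3,4) m by simp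
  have minpoly_iff:
    "?minpoly \<longleftrightarrow> is_minimal_polynomial (ricci_operator br g) [:l\<^sup>2 + m\<^sup>2, - 2 * l, 1:]"
    unfolding map_poly_quadratic[OF assms(1)] by blast
  show ?thesis
    unfolding pair_iff minpoly_iff
  proof
    assume "is_minimal_polynomial (ricci_operator br g) [:l\<^sup>2 + m\<^sup>2, - 2 * l, 1:]"
    then have "einstein_complex_pair br g (ricci br g)
        (\<lambda>x. (1 / m) *\<^sub>R (ricci_operator br g x - l *\<^sub>R x)) l m"
      unfolding is_minimal_polynomial_def poly_apply_quadratic
      by (intro einstein_complex_pair_of_ricci assms m) blast
    \<comment> \<open>Uniqueness: in every such pair both components are given by the same formulas
      in \<open>br\<close> and \<open>g\<close>.\<close>
    then show "\<exists>!(g', J). einstein_complex_pair br g g' J l m"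
      using einstein_complex_pair.metric_eq_ricci einstein_complex_pair.complex_structure_eq
      by (intro ex1I[of _ "(ricci br g, \<lambda>x. (1 / m) *\<^sub>R (ricci_operator br g x - l *\<^sub>R x))"])
        (auto split: prod.splits)
  next
    assume "\<exists>!(g', J). einstein_complex_pair br g g' J l m"
    then obtain g' J where "einstein_complex_pair br g g' J l m" by auto
    then interpret einstein_complex_pair br g g' J l m .
    show "is_minimal_polynomial (ricci_operator br g) [:l\<^sup>2 + m\<^sup>2, - 2 * l, 1:]"
      by (rule minimal_polynomial_complex[OF J m ricci_operator_eq])
  qed
qed

end
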